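(* Even if $n$ is known a priori, the competitive ratio of any randomized online algorithm against an oblivious adversary for minimizing the $\ell_2$ norm of flow time is $\Omega(n^{1/10})$. Precisely: there exist an absolute constant $c>0$ and infinitely many values of $n$ such that for every randomized online algorithm $\mathcal{A}$ that is told $n$ in advance, there is an instance $I$ with exactly $n$ jobs for which $\mathbb{E}\big[\sqrt{F(\mathcal{A}(I))}\big]\ge c\,n^{1/10}\sqrt{F(\mathcal{OPT}(I))}$.
   Context: Problem: a single machine and $n$ jobs; job $J_i$ has integer release time $r_i\ge0$ and integer processing time $p_i\ge1$. Unit slots $[t]=[t,t+1)$; a (preemptive) schedule assigns each slot to at most one job so that $J_i$ receives exactly $p_i$ slots, all with $t\ge r_i$. $c_i(\mathcal{S})$ is the completion time of $J_i$, $f_i(\mathcal{S})=c_i(\mathcal{S})-r_i$, $F(\mathcal{S})=\sum_i f_i(\mathcal{S})^2$, the $\ell_2$ norm of flow time is $\sqrt{F(\mathcal{S})}$, and $\mathcal{OPT}(I)$ minimizes $F$ on instance $I$. An online algorithm learns of job $J_i$ and its processing time $p_i$ only at time $r_i$, and its decision for slot $[t]$ depends only on jobs released by time $t$ (and, here, on $n$). A randomized algorithm's random choices are independent of the instance (oblivious adversary), and $\mathcal{A}(I)$ denotes its (random) schedule on $I$. *)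

theory Defs
  imports "HOL-Probability.Probability"
begin

text \<open>A job is a pair (release time, processing time).\<close>

type_synonym job = "nat \<times> nat"

abbreviation release :: "job \<Rightarrow> nat" where "release \<equiv> fst"
abbreviation proc :: "job \<Rightarrow> nat" where "proc \<equiv> snd"

text \<open>An instance lists its jobs in order of release, so that the index of a job, which is how an
  algorithm refers to it, carries no information about jobs released later.\<close>

definition valid_instance :: "job list \<Rightarrow> bool" where
  "valid_instance I \<longleftrightarrow> sorted (map release I) \<and> (\<forall>j\<in>set I. proc j \<ge> 1)"

text \<open>A schedule maps each unit slot \<open>[t, t + 1)\<close> to the index of the job run in it, or to
  \<open>None\<close> if the machine idles.\<close>

type_synonym schedule = "nat \<Rightarrow> nat option"

definition feasible :: "job list \<Rightarrow> schedule \<Rightarrow> bool" where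
  "feasible I S \<longleftrightarrow>
     (\<forall>t i. S t = Some i \<longrightarrow> i < length I \<and> release (I ! i) \<le> t) \<and>
     (\<forall>i<length I. card {t. S t = Some i} = proc (I ! i))"

definition completion :: "schedule \<Rightarrow> nat \<Rightarrow> nat" where
  "completion S i = Max {t. S t = Some i} + 1"

text \<open>In a feasible schedule of a valid instance every job completes after its release, so the
  natural-number subtraction below does not truncate.\<close>

definition flow :: "job list \<Rightarrow> schedule \<Rightarrow> nat \<Rightarrow> nat" where
  "flow I S i = completion S i - release (I ! i)"

definition sum_sq_flow :: "job list \<Rightarrow> schedule \<Rightarrow> nat" where
  "sum_sq_flow I S = (\<Sum>i<length I. (flow I S i)\<^sup>2)"

definition OPT :: "job list \<Rightarrow> schedule" where
  "OPT I = (ARG_MIN (sum_sq_flow I) S. feasible I S)"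

text \<open>What is known when slot \<open>t\<close> is to be decided: the number \<open>n\<close> of jobs of the whole instance,
  the time \<open>t\<close>, and the jobs released by time \<open>t\<close>. Release times are included, so
  the earlier observations, and hence the earlier decisions of a deterministic algorithm, can be
  recovered from the current observation. On a valid instance the jobs released by time \<open>t\<close>
  form a prefix, so job indices agree with those of the instance.\<close>

type_synonym observation = "nat \<times> nat \<times> job list"

type_synonym decision_rule = "observation \<Rightarrow> nat option"

definition observe :: "job list \<Rightarrow> nat \<Rightarrow> observation" where
  "observe I t = (length I, t, filter (\<lambda>j. release j \<le> t) I)"

definition run :: "decision_rule \<Rightarrow> job list \<Rightarrow> schedule" where
  "run A I = (\<lambda>t. A (observe I t))"

definition online_algorithm :: "decision_rule \<Rightarrow> bool" where
  "online_algorithm A \<longleftrightarrow> (\<forall>I. valid_instance I \<longrightarrow> feasible I (run A I))"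

text \<open>A randomized online algorithm is a probability distribution over deterministic ones, chosen
  independently of the instance. The \<open>\<sigma>\<close>-algebra is the product one, i.e. the smallest that makes
  each single decision a random variable; an algorithm using random bits from an arbitrary
  probability space induces such a distribution.\<close>

definition randomized_online_algorithm :: "decision_rule measure \<Rightarrow> bool" where
  "randomized_online_algorithm \<A> \<longleftrightarrow>
     prob_space \<A> \<and>
     sets \<A> = sets (Pi\<^sub>M UNIV (\<lambda>_. count_space UNIV)) \<and>
     (AE A in \<A>. online_algorithm A)"

text \<open>The expected \<open>\<ell>\<^sub>2\<close> norm of flow time, possibly infinite.\<close>

definition expected_l2_flow :: "decision_rule measure \<Rightarrow> job list \<Rightarrow> ennreal" where
  "expected_l2_flow \<A> I = (\<integral>\<^sup>+ A. ennreal (sqrt (real (sum_sq_flow I (run A I)))) \<partial>\<A>)"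

end

theory Submission imports Defs begin

text \<open>Release at time \<open>0\<close> one big job of size \<open>L k\<close>, and a small job of size \<open>k\<close> every \<open>k\<close> slots
  up to time \<open>T k\<close>, so that the machine is overloaded by \<open>L k\<close>. If the algorithm has not finished
  the big job by time \<open>T k\<close> (with probability at least \<open>1/2\<close>), only the big job matters: running it
  first would have delayed every small job by just \<open>L k\<close>. The \<open>M = T k\<close> remaining unit jobs then
  arrive harmlessly late. Otherwise they arrive one per slot from time \<open>T k\<close> on. The optimum keeps the
  big job waiting to the end, while the algorithm carries a backlog of volume \<open>L k\<close> that consists of
  small or unit jobs: either many small jobs wait for \<open>M / 2\<close> slots, or at least a constant fraction
  of \<open>L k\<close> unit jobs wait at every time of the second half of the stream. The
  choice \<open>k = L\<^sup>2\<close>, \<open>T = L\<^sup>3\<close> balances all the ratios of squared flows at \<open>L\<close>, where \<open>n\<close> is of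
  order \<open>L\<^sup>5\<close>.\<close>

section \<open>Bounds on flows from single slots, and on the optimum from block schedules\<close>

lemma sum_sq_flow_OPT_le: "feasible I S \<Longrightarrow> sum_sq_flow I (OPT I) \<le> sum_sq_flow I S"
  unfolding OPT_def by (rule arg_min_nat_le[of "feasible I" S "sum_sq_flow I"])

text \<open>\<open>card\<close> of an infinite set is \<open>0\<close>, so a positive processing
  time forces finiteness; this makes the \<open>Max\<close> in \<open>completion\<close>
  meaningful.\<close>

lemma feasible_finite_slots:
  assumes "valid_instance I" "feasible I S" "i < length I"
  shows "finite {t. S t = Some i}"
proof -
  have "proc (I ! i) \<ge> 1" using assms(1,3) by (auto simp: valid_instance_def)
  then have "card {t. S t = Some i} > 0" using assms(2,3) by (auto simp: feasible_def)
  then show ?thesis by (simp add: card_gt_0_iff)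
qed

text \<open>Source of every lower bound on a flow below: one late slot suffices. Slot
  \<open>t\<close> ends at time \<open>t + 1\<close>, hence the \<open>+ 1\<close>.\<close>

lemma flow_ge_slot:
  assumes "valid_instance I" "feasible I S" "S t = Some i"
  shows "flow I S i \<ge> t + 1 - release (I ! i)"
proof -
  have "i < length I" using assms by (auto simp: feasible_def)
  then have "t \<le> Max {t. S t = Some i}"
    using feasible_finite_slots[OF assms(1,2)] assms(3) by (intro Max_ge) auto
  then show ?thesis by (simp add: flow_def completion_def)
qed

text \<open>Non-preemptive schedules, given by start times \<open>a\<close> alone, suffice for all
  upper bounds on the optimum below.\<close>

lemma OPT_le_block_schedule:
  fixes a :: "nat \<Rightarrow> nat"
  assumes valid: "valid_instance I"
    and rel: "\<And>i. i < length I \<Longrightarrow> release (I ! i) \<le> a i"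
    and disj: "\<And>i j t. i < length I \<Longrightarrow> j < length I
      \<Longrightarrow> t \<in> {a i..<a i + proc (I ! i)} \<Longrightarrow> t \<in> {a j..<a j + proc (I ! j)} \<Longrightarrow> i = j"
  shows "sum_sq_flow I (OPT I) \<le> (\<Sum>i<length I. (a i + proc (I ! i) - release (I ! i))\<^sup>2)"
proof -
  define B where "B i = {a i..<a i + proc (I ! i)}" for i
  define S where "S t = (if \<exists>i<length I. t \<in> B i
    then Some (THE i. i < length I \<and> t \<in> B i) else None)" for t
  have S_iff: "S t = Some i \<longleftrightarrow> i < length I \<and> t \<in> B i" for t i
  proof -
    have "(THE i. i < length I \<and> t \<in> B i) = i'" if "i' < length I" "t \<in> B i'" for i'
      using that disj unfolding B_def by (intro the_equality) auto
    then show ?thesis unfolding S_def by auto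
  qed
  have slots: "{t. S t = Some i} = B i" if "i < length I" for i
    using that by (auto simp: S_iff)
  have feas: "feasible I S"
    unfolding feasible_def using slots rel by (auto simp: S_iff B_def dest: le_trans)
  have "flow I S i = a i + proc (I ! i) - release (I ! i)" if i: "i < length I" for i
  proof -
    have "proc (I ! i) \<ge> 1" using valid i by (auto simp: valid_instance_def)
    then have "Max (B i) = a i + proc (I ! i) - 1"
      unfolding B_def by (intro Max_eqI) auto
    then show ?thesis
      using \<open>proc (I ! i) \<ge> 1\<close> by (simp add: flow_def completion_def slots i)
  qed
  then show ?thesis
    using sum_sq_flow_OPT_le[OF feas] by (simp add: sum_sq_flow_def)
qed

section \<open>The family of hard instances\<close>

definition hard_prefix :: "nat \<Rightarrow> nat \<Rightarrow> nat \<Rightarrow> job list" where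
  "hard_prefix L k T = (0, L * k) # map (\<lambda>i. (i * k, k)) [0..<T]"

text \<open>Only \<open>R\<close> is left to the adversary in the end. The number of jobs does not
  depend on it, so knowing \<open>n\<close> does not reveal it.\<close>

definition hard_instance :: "nat \<Rightarrow> nat \<Rightarrow> nat \<Rightarrow> nat \<Rightarrow> nat \<Rightarrow> job list" where
  "hard_instance L k T M R = hard_prefix L k T @ map (\<lambda>j. (R + j, 1)) [0..<M]"

lemma length_hard_instance [simp]: "length (hard_instance L k T M R) = Suc (T + M)"
  by (simp add: hard_instance_def hard_prefix_def)

lemma nth_hard_instance [simp]:
  "hard_instance L k T M R ! 0 = (0, L * k)"
  "i < T \<Longrightarrow> hard_instance L k T M R ! Suc i = (i * k, k)"
  "j < M \<Longrightarrow> hard_instance L k T M R ! Suc (T + j) = (R + j, 1)"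
  by (auto simp: hard_instance_def hard_prefix_def nth_append)

lemma index_hard_instance_cases:
  assumes "i < Suc (T + M)"
  obtains "i = 0" | i' where "i = Suc i'" "i' < T" | j where "i = Suc (T + j)" "j < M"
proof (cases i)
  case (Suc i')
  show ?thesis
  proof (cases "i' < T")
    case False
    then have "i = Suc (T + (i' - T))" "i' - T < M" using Suc assms by auto
    then show ?thesis using that by blast
  qed (use Suc that in blast)
qed (use that in blast)

lemma sum_hard_instance:
  fixes f :: "nat \<Rightarrow> 'a::comm_monoid_add"
  shows "(\<Sum>i<Suc (T + M). f i) = f 0 + (\<Sum>i<T. f (Suc i)) + (\<Sum>j<M. f (Suc (T + j)))"
proof (induction M)
  case 0
  show ?case by (simp add: sum.lessThan_Suc_shift del: sum.lessThan_Suc)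
qed (simp add: add.assoc)

lemma valid_hard_instance:
  assumes "L * k \<ge> 1" "k \<ge> 1" "T * k \<le> R"
  shows "valid_instance (hard_instance L k T M R)"
proof -
  have "i * k \<le> t" if "i < T" "R \<le> t" for i t
    using that assms by (meson le_trans less_imp_le_nat mult_le_mono1)
  moreover have "sorted (map release (map (\<lambda>i. (i * k, k)) [0..<T]))"
    "sorted (map release (map (\<lambda>j. (R + j, 1::nat)) [0..<M]))"
    by (auto simp: sorted_iff_nth_mono)
  ultimately show ?thesis
    using assms
    by (auto simp: valid_instance_def hard_instance_def hard_prefix_def sorted_append)
qed

text \<open>\<open>R\<close> does not occur on the right: until the unit jobs arrive, instances that
  differ only in \<open>R\<close> look the same to the algorithm.\<close>

lemma observe_hard_instance:
  assumes "t < R"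
  shows "observe (hard_instance L k T M R) t
    = (Suc (T + M), t, filter (\<lambda>j. release j \<le> t) (hard_prefix L k T))"
proof -
  have "filter (\<lambda>j. release j \<le> t) (map (\<lambda>j. (R + j, 1::nat)) [0..<M]) = []"
    using assms by (auto simp: filter_empty_conv)
  then show ?thesis
    by (simp add: observe_def) (simp add: hard_instance_def)
qed

text \<open>The witness starts the big job at \<open>x\<close>, delays every small job by
  \<open>y\<close> and runs each unit job on arrival. It is used with \<open>x = 0\<close>,
  \<open>y = L * k\<close> (big job first) and with \<open>x = R + M\<close>, \<open>y = 0\<close>
  (big job last).\<close>

lemma OPT_hard_instance_le:
  assumes pos: "L * k \<ge> 1" "k \<ge> 1"
    and y: "y + T * k \<le> R" and x: "x + L * k \<le> y \<or> R + M \<le> x"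
  shows "sum_sq_flow (hard_instance L k T M R) (OPT (hard_instance L k T M R))
    \<le> (x + L * k)\<^sup>2 + T * (y + k)\<^sup>2 + M"
proof -
  let ?I = "hard_instance L k T M R"
  define a where "a i = (if i = 0 then x else if i \<le> T then y + (i - 1) * k else R + (i - T - 1))"
    for i
  have a: "a 0 = x" "\<And>i. i < T \<Longrightarrow> a (Suc i) = y + i * k" "\<And>j. a (Suc (T + j)) = R + j"
    by (auto simp: a_def)
  \<comment> \<open>Small jobs are spaced by exactly their length, so a common shift keeps them
    disjoint; \<open>j = T\<close> bounds the end of the last one.\<close>
  have step: "i * k + k \<le> j * k" if "i < j" for i j
  proof -
    have "Suc i * k \<le> j * k" using that by (intro mult_le_mono1) auto
    then show ?thesis by simp
  qed
  have "sum_sq_flow ?I (OPT ?I) \<le> (\<Sum>i<length ?I. (a i + proc (?I ! i) - release (?I ! i))\<^sup>2)"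
  proof (rule OPT_le_block_schedule)
    show "valid_instance ?I" using pos y by (intro valid_hard_instance) auto
    show "release (?I ! i) \<le> a i" if "i < length ?I" for i
      using that by (auto elim!: index_hard_instance_cases simp: a)
    show "i = j" if "i < length ?I" "j < length ?I"
      "t \<in> {a i..<a i + proc (?I ! i)}" "t \<in> {a j..<a j + proc (?I ! j)}" for i j t
    proof (rule ccontr)
      have False if ij: "i < j" "j < length ?I"
        and t: "t \<in> {a i..<a i + proc (?I ! i)}" "t \<in> {a j..<a j + proc (?I ! j)}" for i j
      proof -
        have i: "i < Suc (T + M)" and j: "j < Suc (T + M)" using ij by auto
        from i show False
        proof (cases rule: index_hard_instance_cases)
          case 1
          from j show False
          proof (cases rule: index_hard_instance_cases)
            case (2 j')
            then show False using 1 t x y step[of j' T] by (simp add: a)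
          qed (use 1 ij t x y in \<open>auto simp: a\<close>)
        next
          case (2 i')
          from j show False
          proof (cases rule: index_hard_instance_cases)
            case (2 j')
            then show False using \<open>i = Suc i'\<close> \<open>i' < T\<close> ij t step[of i' j'] by (simp add: a)
          next
            case (3 j')
            then show False using 2 t y step[of i' T] by (simp add: a)
          qed (use ij in auto)
        next
          case (3 i')
          from j show False
            by (cases rule: index_hard_instance_cases) (use 3 ij t in \<open>auto simp: a\<close>)
        qed
      qed
      moreover assume "i \<noteq> j"
      ultimately show False using that by (meson linorder_neqE_nat)
    qed
  qed
  also have "\<dots> = (x + L * k)\<^sup>2 + T * (y + k)\<^sup>2 + M"
    by (simp add: sum_hard_instance a del: sum.lessThan_Suc)
  finally show ?thesis .
qed

section \<open>Lower bounds on the cost of the algorithm\<close>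

lemma unfinished_big_job_cost:
  assumes valid: "valid_instance (hard_instance L k T M R)"
    and feas: "feasible (hard_instance L k T M R) S"
    and less: "card {t. t < D \<and> S t = Some 0} < L * k"
  shows "sum_sq_flow (hard_instance L k T M R) S \<ge> D\<^sup>2"
proof -
  let ?I = "hard_instance L k T M R"
  \<comment> \<open>The big job needs \<open>L * k\<close> slots in total, so one of them is at
    \<open>D\<close> or later; its release time is \<open>0\<close>.\<close>
  have "card {t. S t = Some 0} = L * k" using feas by (force simp: feasible_def)
  then have "{t. S t = Some 0} \<noteq> {t. t < D \<and> S t = Some 0}"
    using less by (metis less_irrefl)
  moreover have "{t. S t = Some 0} = {t. t < D \<and> S t = Some 0}" if "\<not> (\<exists>t\<ge>D. S t = Some 0)"
    using that by (intro Collect_cong) (metis linorder_not_le)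
  ultimately obtain t where "t \<ge> D" "S t = Some 0" by blast
  then have "flow ?I S 0 \<ge> D" using flow_ge_slot[OF valid feas, of t 0] by simp
  then have "D\<^sup>2 \<le> (flow ?I S 0)\<^sup>2" by (rule power_mono) simp
  also have "\<dots> \<le> sum_sq_flow ?I S"
    unfolding sum_sq_flow_def by (rule member_le_sum) auto
  finally show ?thesis .
qed

text \<open>Case split at the midpoint of the stream: either \<open>2 * m\<close> small jobs still
  run there, or half of the backlog \<open>4 * m * k\<close> was worked off at the expense of unit
  jobs, which then queue up. The shapes \<open>4 * m\<close> and \<open>2 * H\<close> keep all
  fractions integral.\<close>

lemma stream_cost:
  assumes M: "M = 2 * H" and pos: "m \<ge> 1" "k \<ge> 1"
    and feas: "feasible (hard_instance (4 * m) k T M (T * k)) S"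
    and big: "card {t. t < T * k \<and> S t = Some 0} \<ge> 4 * m * k"
  shows "2 * m * H\<^sup>2 \<le> sum_sq_flow (hard_instance (4 * m) k T M (T * k)) S
    \<or> M * (m * k)\<^sup>2 \<le> sum_sq_flow (hard_instance (4 * m) k T M (T * k)) S"
proof -
  let ?I = "hard_instance (4 * m) k T M (T * k)"
  define \<tau> where "\<tau> = T * k + H"
  define small where "small = {t. \<exists>i<T. S t = Some (Suc i)}"
  have valid: "valid_instance ?I" using pos by (intro valid_hard_instance) auto
  have F: "sum_sq_flow ?I S
      = (flow ?I S 0)\<^sup>2 + (\<Sum>i<T. (flow ?I S (Suc i))\<^sup>2) + (\<Sum>j<M. (flow ?I S (Suc (T + j)))\<^sup>2)"
    by (simp add: sum_sq_flow_def sum_hard_instance del: sum.lessThan_Suc)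
  have fin: "finite {t. S t = Some i}" if "i < Suc (T + M)" for i
    using feasible_finite_slots[OF valid feas] that by simp
  have card_small: "card {t. S t = Some (Suc i)} = k" if "i < T" for i
    using feas that by (force simp: feasible_def)
  have card_unit: "card {t. S t = Some (Suc (T + j))} = 1" if "j < M" for j
    using feas that by (force simp: feasible_def)
  have small_UN: "small = (\<Union>i<T. {t. S t = Some (Suc i)})" by (auto simp: small_def)
  have fin_small: "finite small" unfolding small_UN using fin by auto
  have total_small: "card small = T * k"
  proof -
    have "card small = (\<Sum>i<T. card {t. S t = Some (Suc i)})"
      unfolding small_UN by (rule card_UN_disjoint) (auto intro: fin)
    then show ?thesis by (simp add: card_small)
  qed
  \<comment> \<open>Slots before \<open>T * k\<close> that go to the big job are lost to the small
    ones, whose total volume is \<open>T * k\<close>.\<close>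
  have early: "card (small \<inter> {..<T * k}) + 4 * m * k \<le> T * k"
  proof -
    have "card (small \<inter> {..<T * k}) + card {t. t < T * k \<and> S t = Some 0}
        = card (small \<inter> {..<T * k} \<union> {t. t < T * k \<and> S t = Some 0})"
      by (rule card_Un_disjoint[symmetric]) (auto simp: small_def)
    also have "\<dots> \<le> card {..<T * k}" by (intro card_mono) auto
    finally show ?thesis using big by simp
  qed
  define late where "late = {i. i < T \<and> (\<exists>t\<ge>\<tau>. S t = Some (Suc i))}"
  have fin_late: "finite late" by (simp add: late_def)
  show ?thesis
  proof (cases "2 * m \<le> card late")
    case True
    have "H \<le> flow ?I S (Suc i)" if "i \<in> late" for i
    proof -
      from that obtain t where t: "i < T" "t \<ge> \<tau>" "S t = Some (Suc i)" by (auto simp: late_def)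
      have "i * k \<le> T * k" using t by simp
      moreover have "t + 1 - i * k \<le> flow ?I S (Suc i)"
        using flow_ge_slot[OF valid feas t(3)] t by simp
      ultimately show ?thesis using t unfolding \<tau>_def by linarith
    qed
    then have "(\<Sum>i\<in>late. H\<^sup>2) \<le> (\<Sum>i\<in>late. (flow ?I S (Suc i))\<^sup>2)"
      by (intro sum_mono power_mono) auto
    also have "\<dots> \<le> (\<Sum>i<T. (flow ?I S (Suc i))\<^sup>2)"
      by (rule sum_mono2) (auto simp: late_def)
    finally have "card late * H\<^sup>2 \<le> sum_sq_flow ?I S" using F by simp
    moreover have "2 * m * H\<^sup>2 \<le> card late * H\<^sup>2" using True by (rule mult_le_mono1)
    ultimately show ?thesis by linarith
  next
    case False
    \<comment> \<open>Small work from \<open>\<tau>\<close> on belongs to fewer than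
      \<open>2 * m\<close> jobs of size \<open>k\<close>; so at least \<open>2 * m * k\<close> of
      the backlog was processed in the first half of the stream.\<close>
    have "small \<inter> {\<tau>..} \<subseteq> (\<Union>i\<in>late. {t. S t = Some (Suc i)})"
      by (auto simp: small_def late_def)
    then have "card (small \<inter> {\<tau>..}) \<le> card (\<Union>i\<in>late. {t. S t = Some (Suc i)})"
      using fin fin_late by (intro card_mono) (auto simp: late_def)
    also have "\<dots> \<le> (\<Sum>i\<in>late. card {t. S t = Some (Suc i)})"
      using fin_late by (rule card_UN_le)
    also have "\<dots> = card late * k" by (simp add: card_small late_def)
    also have "\<dots> \<le> 2 * m * k" using False by simp
    finally have tail: "card (small \<inter> {\<tau>..}) \<le> 2 * m * k" .
    have "card small = card (small \<inter> {..<T * k}) + card (small \<inter> {T * k..<\<tau>})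
        + card (small \<inter> {\<tau>..})"
    proof -
      have "small = (small \<inter> {..<T * k} \<union> small \<inter> {T * k..<\<tau>}) \<union> small \<inter> {\<tau>..}"
        by (auto simp: \<tau>_def)
      then have "card small = card ((small \<inter> {..<T * k} \<union> small \<inter> {T * k..<\<tau>}) \<union> small \<inter> {\<tau>..})"
        by simp
      also have "\<dots> = card (small \<inter> {..<T * k} \<union> small \<inter> {T * k..<\<tau>}) + card (small \<inter> {\<tau>..})"
        using fin_small by (intro card_Un_disjoint) (auto simp: \<tau>_def)
      also have "card (small \<inter> {..<T * k} \<union> small \<inter> {T * k..<\<tau>})
          = card (small \<inter> {..<T * k}) + card (small \<inter> {T * k..<\<tau>})"
        using fin_small by (intro card_Un_disjoint) auto
      finally show ?thesis .
    qed
    then have mid: "card (small \<inter> {T * k..<\<tau>}) \<ge> 2 * m * k"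
      using total_small early tail by linarith
    define slot where "slot j = (THE t. S t = Some (Suc (T + j)))" for j
    have slot_iff: "S t = Some (Suc (T + j)) \<longleftrightarrow> t = slot j" if j: "j < M" for j t
    proof -
      obtain u where "{t. S t = Some (Suc (T + j))} = {u}"
        using card_unit[OF j] by (auto simp: card_1_singleton_iff)
      then have u: "S t = Some (Suc (T + j)) \<longleftrightarrow> t = u" for t by (simp add: set_eq_iff)
      then show ?thesis by (simp add: slot_def)
    qed
    then have S_slot: "S (slot j) = Some (Suc (T + j))" if "j < M" for j using that by simp
    have slot_release: "slot j \<ge> T * k + j" if j: "j < M" for j
    proof -
      have "release (?I ! Suc (T + j)) \<le> slot j"
        using feas S_slot[OF j] unfolding feasible_def by blast
      then show ?thesis using j by simp
    qed
    have flow_unit: "flow ?I S (Suc (T + j)) \<ge> slot j + 1 - (T * k + j)" if j: "j < M" for j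
      using flow_ge_slot[OF valid feas S_slot[OF j]] j by simp
    \<comment> \<open>By time \<open>t\<close>, \<open>t - T * k + 1\<close> unit jobs have arrived,
      while the slots taken by small jobs leave room for at most
      \<open>t - T * k - 2 * m * k\<close> of them to be done.\<close>
    have waiting: "2 * m * k \<le> card {j. j < M \<and> T * k + j \<le> t \<and> t \<le> slot j}"
      if t: "t \<in> {\<tau>..<T * k + M}" for t
    proof -
      let ?R = "{..t - T * k}" and ?D = "{j. j < M \<and> slot j < t}"
      have "inj_on slot ?D"
      proof (rule inj_onI)
        fix i j assume "i \<in> ?D" "j \<in> ?D" and eq: "slot i = slot j"
        then have "i < M" "j < M" by auto
        from S_slot[OF this(1)] S_slot[OF this(2)] show "i = j" unfolding eq by simp
      qed
      moreover have "slot ` ?D \<inter> small = {}"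
        by (auto simp: small_def S_slot)
      moreover have "slot ` ?D \<subseteq> {T * k..<t}"
        by (auto dest!: slot_release)
      ultimately have "card ?D + card (small \<inter> {T * k..<\<tau>}) \<le> card {T * k..<t}"
      proof -
        assume *: "inj_on slot ?D" "slot ` ?D \<inter> small = {}" "slot ` ?D \<subseteq> {T * k..<t}"
        have "card ?D + card (small \<inter> {T * k..<\<tau>}) = card (slot ` ?D \<union> small \<inter> {T * k..<\<tau>})"
          using *(2) card_image[OF *(1)] fin_small
          by (subst card_Un_disjoint) auto
        also have "\<dots> \<le> card {T * k..<t}" using *(3) t by (intro card_mono) auto
        finally show ?thesis .
      qed
      then have D: "card ?D + 2 * m * k \<le> t - T * k" using mid by simp
      have "?R \<subseteq> {j. j < M \<and> T * k + j \<le> t \<and> t \<le> slot j} \<union> ?D"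
        using t by (auto simp: \<tau>_def)
      then have "card ?R \<le> card ({j. j < M \<and> T * k + j \<le> t \<and> t \<le> slot j} \<union> ?D)"
        by (intro card_mono) auto
      also have "\<dots> \<le> card {j. j < M \<and> T * k + j \<le> t \<and> t \<le> slot j} + card ?D"
        by (rule card_Un_le)
      finally show ?thesis using D by simp
    qed
    let ?W = "{\<tau>..<T * k + M}"
    \<comment> \<open>Double counting of pairs of a slot in the second half and a unit job waiting
      then; a job occurs at most as often as its flow. As \<open>M = 2 * H\<close>, the average flow
      of the unit jobs is at least \<open>m * k\<close>.\<close>
    have "H * (2 * m * k) = (\<Sum>t\<in>?W. 2 * m * k)" by (simp add: \<tau>_def M)
    also have "\<dots> \<le> (\<Sum>t\<in>?W. card {j \<in> {..<M}. T * k + j \<le> t \<and> t \<le> slot j})"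
      using waiting by (intro sum_mono) simp
    also have "\<dots> = (\<Sum>j<M. card {t \<in> ?W. T * k + j \<le> t \<and> t \<le> slot j})"
      by (rule sum_multicount_gen[symmetric]) auto
    also have "\<dots> \<le> (\<Sum>j<M. flow ?I S (Suc (T + j)))"
    proof (rule sum_mono)
      fix j assume "j \<in> {..<M}"
      then have "slot j + 1 - (T * k + j) \<le> flow ?I S (Suc (T + j))"
        using flow_unit[of j] by simp
      moreover have "card {t \<in> ?W. T * k + j \<le> t \<and> t \<le> slot j} \<le> card {T * k + j..slot j}"
        by (intro card_mono) auto
      ultimately show "card {t \<in> ?W. T * k + j \<le> t \<and> t \<le> slot j} \<le> flow ?I S (Suc (T + j))"
        by simp
    qed
    finally have "real (H * (2 * m * k)) \<le> real (\<Sum>j<M. flow ?I S (Suc (T + j)))"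
      by (simp only: of_nat_le_iff)
    then have total: "real H * (2 * (m * k)) \<le> (\<Sum>j<M. real (flow ?I S (Suc (T + j))))"
      by (simp add: mult.assoc)
    \<comment> \<open>Summing \<open>f\<^sup>2 \<ge> 2 a f - a\<^sup>2\<close> bounds the squared flows by the total flow;
      \<open>a\<close> is half of the average flow just obtained.\<close>
    define a where "a = real (m * k)"
    have "real (M * (m * k)\<^sup>2) = 2 * a * (real H * (2 * a)) - M * a\<^sup>2"
      by (simp add: a_def M power2_eq_square)
    also have "\<dots> \<le> 2 * a * (\<Sum>j<M. real (flow ?I S (Suc (T + j)))) - M * a\<^sup>2"
      using total unfolding a_def by (intro diff_right_mono mult_left_mono) auto
    also have "\<dots> = (\<Sum>j<M. 2 * a * real (flow ?I S (Suc (T + j))) - a\<^sup>2)"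
      by (simp add: sum_subtractf sum_distrib_left)
    also have "\<dots> \<le> (\<Sum>j<M. (real (flow ?I S (Suc (T + j))))\<^sup>2)"
    proof (rule sum_mono)
      fix j
      have "0 \<le> (real (flow ?I S (Suc (T + j))) - a)\<^sup>2" by simp
      then show "2 * a * real (flow ?I S (Suc (T + j))) - a\<^sup>2
          \<le> (real (flow ?I S (Suc (T + j))))\<^sup>2"
        by (simp add: power2_diff algebra_simps)
    qed
    also have "\<dots> = real (\<Sum>j<M. (flow ?I S (Suc (T + j)))\<^sup>2)" by simp
    finally have "M * (m * k)\<^sup>2 \<le> (\<Sum>j<M. (flow ?I S (Suc (T + j)))\<^sup>2)"
      by (simp only: of_nat_le_iff)
    then show ?thesis using F by simp
  qed
qed

section \<open>Passage to expectations, and the constants\<close>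

lemma expected_l2_flow_ge:
  assumes alg: "randomized_online_algorithm \<A>" and "valid_instance I" and E: "E \<in> sets \<A>"
    and half: "measure \<A> E \<ge> 1 / 2" and "v \<ge> 0"
    and cost: "\<And>A. feasible I (run A I) \<Longrightarrow> A \<in> E \<Longrightarrow> v \<le> real (sum_sq_flow I (run A I))"
  shows "expected_l2_flow \<A> I \<ge> ennreal (sqrt v / 2)"
proof -
  interpret prob_space \<A> using alg by (simp add: randomized_online_algorithm_def)
  have "AE A in \<A>. online_algorithm A" using alg by (simp add: randomized_online_algorithm_def)
  then have AE: "AE A in \<A>. ennreal (sqrt v) * indicator E A
      \<le> ennreal (sqrt (real (sum_sq_flow I (run A I))))"
  proof eventually_elim
    case (elim A)
    then have "feasible I (run A I)" using assms(2) by (simp add: online_algorithm_def)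
    then show ?case using cost[of A] by (auto simp: indicator_def intro: ennreal_leI)
  qed
  \<comment> \<open>Only the cost on \<open>E\<close> is counted, which loses the factor
    \<open>1 / 2\<close>.\<close>
  have "ennreal (sqrt v / 2) \<le> ennreal (sqrt v * measure \<A> E)"
    using mult_left_mono[OF half, of "sqrt v"] \<open>v \<ge> 0\<close> by (intro ennreal_leI) simp
  also have "\<dots> = (\<integral>\<^sup>+ A. ennreal (sqrt v) * indicator E A \<partial>\<A>)"
    using E \<open>v \<ge> 0\<close> by (simp add: nn_integral_cmult_indicator emeasure_eq_measure ennreal_mult)
  also have "\<dots> \<le> expected_l2_flow \<A> I"
    unfolding expected_l2_flow_def using AE by (rule nn_integral_mono_AE)
  finally show ?thesis .
qed

text \<open>\<open>x\<close> is the scale of the squared optimum. Since \<open>n\<close> is of order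
  \<open>L ^ 5\<close>, the gain \<open>sqrt L\<close> is of order \<open>n powr (1 / 10)\<close>.
  The constant fits exactly: \<open>1 / 64 * 2 * 4 = 1 / 8\<close>.\<close>

lemma competitive_ratio_arith:
  assumes L: "L \<ge> 1" and n: "n = Suc (L ^ 3 + L ^ 5)" and x: "(x::real) \<ge> 0"
    and F: "F \<ge> 0" and opt: "F \<le> 16 * x"
  shows "1 / 64 * real n powr (1 / 10) * sqrt F \<le> sqrt (real L * x / 16) / 2"
proof -
  have "L ^ 3 \<le> L ^ 5" "1 \<le> L ^ 5" using L by (auto intro: power_increasing)
  then have "n \<le> 3 * L ^ 5" using n by linarith
  \<comment> \<open>The crude factor \<open>2 ^ 10\<close> has tenth root \<open>2\<close>.\<close>
  also have "\<dots> \<le> 2 ^ 10 * L ^ 5" by simp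
  finally have "real n \<le> real (2 ^ 10 * L ^ 5)" by (simp only: of_nat_le_iff)
  also have "\<dots> = (2 * sqrt L) ^ 10"
  proof -
    have "sqrt L ^ 10 = (sqrt L ^ 2) ^ 5" by (subst power_mult[symmetric]) simp
    then show ?thesis by (simp add: power_mult_distrib)
  qed
  finally have "root 10 (real n) \<le> root 10 ((2 * sqrt L) ^ 10)"
    by (intro real_root_le_mono) auto
  moreover have "root 10 (real n) = real n powr (1 / 10)"
    using root_powr_inverse[of 10 "real n"] n by simp
  moreover have "root 10 ((2 * sqrt L) ^ 10) = 2 * sqrt L"
    by (rule real_root_power_cancel) auto
  ultimately have "real n powr (1 / 10) \<le> 2 * sqrt L" by simp
  moreover have "sqrt F \<le> 4 * sqrt x"
    using real_sqrt_le_mono[OF opt] by (simp add: real_sqrt_mult)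
  ultimately have "real n powr (1 / 10) * sqrt F \<le> 2 * sqrt L * (4 * sqrt x)"
    using F by (intro mult_mono') auto
  then show ?thesis by (simp add: real_sqrt_mult real_sqrt_divide mult_ac)
qed

section \<open>The adversary's choice of \<open>R\<close>\<close>

theorem theoremF1:
  "\<exists>c::real. c > 0 \<and> (\<exists>N::nat set. infinite N \<and>
     (\<forall>n\<in>N. \<forall>\<A>. randomized_online_algorithm \<A> \<longrightarrow>
       (\<exists>I. valid_instance I \<and> length I = n \<and>
          expected_l2_flow \<A> I
            \<ge> ennreal (c * real n powr (1 / 10) * sqrt (real (sum_sq_flow I (OPT I)))))))"
proof (intro exI[of _ "1 / 64 :: real"] conjI ballI allI impI
    exI[of _ "range (\<lambda>m. Suc ((4 * Suc m) ^ 3 + (4 * Suc m) ^ 5)) :: nat set"])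
  show "(1 / 64 :: real) > 0" by simp
  \<comment> \<open>One big job, \<open>L ^ 3\<close> small and \<open>L ^ 5\<close> unit jobs, with
    \<open>L\<close> a positive multiple of \<open>4\<close> as in
    \<open>stream_cost\<close>.\<close>
  let ?n = "\<lambda>m. Suc ((4 * Suc m) ^ 3 + (4 * Suc m) ^ 5) :: nat"
  have "strict_mono ?n"
  proof (rule strict_monoI)
    fix a b :: nat assume "a < b"
    then have "(4 * Suc a) ^ e < (4 * Suc b) ^ e" if "e > 0" for e
      using that by (intro power_strict_mono) auto
    then show "?n a < ?n b" by (intro Suc_mono add_strict_mono) simp_all
  qed
  then show "infinite (range ?n)"
    by (intro range_inj_infinite strict_mono_imp_inj_on)
  fix n \<A>
  assume "n \<in> range ?n" and alg: "randomized_online_algorithm \<A>"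
  then obtain m' where "n = ?n m'" by blast
  define m where "m = Suc m'"
  define L where "L = 4 * m"
  define k where "k = L\<^sup>2"
  define T where "T = L ^ 3"
  define M where "M = T * k"
  define I where "I = hard_instance L k T M"
  have Lpos: "L \<ge> 1" and mpos: "m \<ge> 1" by (auto simp: L_def m_def)
  then have pos: "L * k \<ge> 1" "k \<ge> 1" by (auto simp: k_def)
  have M_eq: "M = L ^ 5" by (simp add: M_def T_def k_def flip: power_add)
  then have n: "n = Suc (L ^ 3 + L ^ 5)"
    using \<open>n = ?n m'\<close> by (simp only: L_def m_def)
  have len: "length (I R) = n" for R by (simp only: I_def length_hard_instance M_eq T_def n)
  have valid: "valid_instance (I R)" if "T * k \<le> R" for R
    unfolding I_def using pos that by (rule valid_hard_instance)
  define ob where "ob t = (n, t, filter (\<lambda>j. release j \<le> t) (hard_prefix L k T))" for t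
  have run: "run A (I R) t = A (ob t)" if "T * k \<le> R" "t < T * k" for A R t
    using that by (simp add: run_def I_def observe_hard_instance ob_def n M_eq T_def)
  \<comment> \<open>Expressed through \<open>ob\<close>, this depends on \<open>A\<close> alone. So
    the event \<open>E\<close>, that the big job is unfinished at \<open>T * k\<close>, has a
    probability known before \<open>R\<close> is chosen.\<close>
  define busy where "busy A = {t. t < T * k \<and> A (ob t) = Some 0}" for A :: decision_rule
  define E where "E = {A \<in> space \<A>. card (busy A) < L * k}"
  have run_busy: "{t. t < T * k \<and> run A (I R) t = Some 0} = busy A" if "T * k \<le> R" for A R
    unfolding busy_def using run[OF that] by auto
  have sets: "sets \<A> = sets (Pi\<^sub>M UNIV (\<lambda>_. count_space UNIV))"
    and prob: "prob_space \<A>"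
    using alg by (auto simp: randomized_online_algorithm_def)
  \<comment> \<open>\<open>E\<close> is determined by the decisions at finitely many
    observations.\<close>
  have E: "E \<in> sets \<A>"
  proof -
    have "(\<lambda>A. A (ob t)) \<in> measurable (Pi\<^sub>M UNIV (\<lambda>_. count_space UNIV)) (count_space UNIV)" for t
      by (rule measurable_component_singleton) simp
    then have coord: "(\<lambda>A. A (ob t)) \<in> measurable \<A> (count_space UNIV)" for t
      using measurable_cong_sets[OF sets refl] by blast
    have "card (busy A) = (\<Sum>t<T * k. if A (ob t) = Some 0 then 1 else 0)" for A
      by (simp add: busy_def sum.If_cases Int_def lessThan_def)
    moreover have "(\<lambda>A. \<Sum>t<T * k. if A (ob t) = Some 0 then 1 else 0 :: nat)
        \<in> measurable \<A> (count_space UNIV)"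
      using coord by measurable
    ultimately show ?thesis unfolding E_def by simp
  qed
  \<comment> \<open>Common end of both cases, applied with \<open>x = L ^ 9\<close> on
    \<open>E\<close> and \<open>x = L ^ 10\<close> on its complement.\<close>
  have ratio: "ennreal (1 / 64 * real n powr (1 / 10) * sqrt (real (sum_sq_flow (I R) (OPT (I R)))))
      \<le> expected_l2_flow \<A> (I R)"
    if R: "T * k \<le> R" and E': "E' \<in> sets \<A>" "measure \<A> E' \<ge> 1 / 2" and "x \<ge> 0"
      and opt: "real (sum_sq_flow (I R) (OPT (I R))) \<le> 16 * x"
      and cost: "\<And>A. feasible (I R) (run A (I R)) \<Longrightarrow> A \<in> E'
        \<Longrightarrow> real L * x / 16 \<le> real (sum_sq_flow (I R) (run A (I R)))"
    for R E' x
  proof -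
    have "expected_l2_flow \<A> (I R) \<ge> ennreal (sqrt (real L * x / 16) / 2)"
      using \<open>x \<ge> 0\<close> by (intro expected_l2_flow_ge[OF alg valid[OF R] E'] cost) auto
    moreover note ennreal_leI[OF competitive_ratio_arith[OF Lpos n \<open>x \<ge> 0\<close> of_nat_0_le_iff opt]]
    ultimately show ?thesis by (rule order_trans[rotated])
  qed
  interpret prob_space \<A> by (rule prob)
  consider "measure \<A> E \<ge> 1 / 2" | "measure \<A> (space \<A> - E) \<ge> 1 / 2"
    using prob_compl[OF E] by linarith
  then have "\<exists>R\<ge>T * k. ennreal (1 / 64 * real n powr (1 / 10)
      * sqrt (real (sum_sq_flow (I R) (OPT (I R))))) \<le> expected_l2_flow \<A> (I R)"
  proof cases
    case 1
    \<comment> \<open>With the big job first, the delayed small jobs end exactly when the unit jobs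
      start. They dominate the optimum with \<open>4 * L ^ 9\<close>, against \<open>L ^ 10\<close>
      for the algorithm's big job.\<close>
    define R where "R = L * k + T * k"
    have R: "T * k \<le> R" by (simp add: R_def)
    have "sum_sq_flow (I R) (OPT (I R)) \<le> (0 + L * k)\<^sup>2 + T * (L * k + k)\<^sup>2 + M"
      unfolding I_def using pos by (rule OPT_hard_instance_le) (auto simp: R_def)
    also have "\<dots> \<le> (L * k)\<^sup>2 + T * (2 * L * k)\<^sup>2 + M"
      using Lpos by (intro add_mono mult_le_mono power_mono) (auto simp: algebra_simps)
    also have "\<dots> = L ^ 6 + 4 * L ^ 9 + L ^ 5"
      unfolding M_eq T_def k_def by algebra
    also have "\<dots> \<le> L ^ 9 + 4 * L ^ 9 + L ^ 9"
      using Lpos by (intro add_mono power_increasing) auto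
    also have "\<dots> \<le> 16 * L ^ 9" by simp
    finally have "real (sum_sq_flow (I R) (OPT (I R))) \<le> real (16 * L ^ 9)"
      by (simp only: of_nat_le_iff)
    then have "real (sum_sq_flow (I R) (OPT (I R))) \<le> 16 * real L ^ 9" by simp
    moreover have "real L * real L ^ 9 / 16 \<le> real (sum_sq_flow (I R) (run A (I R)))"
      if "feasible (I R) (run A (I R))" "A \<in> E" for A
    proof -
      have "M\<^sup>2 \<le> sum_sq_flow (I R) (run A (I R))"
        using valid[OF R] that run_busy[OF R] unfolding I_def
        by (intro unfinished_big_job_cost) (auto simp: E_def M_def)
      then have "real M ^ 2 \<le> real (sum_sq_flow (I R) (run A (I R)))"
        by (simp only: of_nat_le_iff flip: of_nat_power)
      moreover have "real L * real L ^ 9 = real M ^ 2"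
        unfolding M_eq by (simp flip: power_mult power_Suc)
      ultimately show ?thesis using zero_le_power2[of "real M"] by linarith
    qed
    ultimately show ?thesis using R ratio[OF R E 1] by auto
  next
    case 2
    \<comment> \<open>The big job runs last, after the stream; its flow
      \<open>2 * L ^ 5 + L ^ 3\<close> dominates the optimum.\<close>
    define R where "R = T * k"
    have R: "T * k \<le> R" by (simp add: R_def)
    have "sum_sq_flow (I R) (OPT (I R)) \<le> ((T * k + M) + L * k)\<^sup>2 + T * (0 + k)\<^sup>2 + M"
      unfolding I_def using pos by (rule OPT_hard_instance_le) (auto simp: R_def)
    also have "T * k + M + L * k = 2 * L ^ 5 + L ^ 3"
      unfolding M_eq T_def k_def by algebra
    also have "T * (0 + k)\<^sup>2 = L ^ 7"
      unfolding T_def k_def by algebra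
    also have "(2 * L ^ 5 + L ^ 3)\<^sup>2 + L ^ 7 + M \<le> (2 * L ^ 5 + L ^ 5)\<^sup>2 + L ^ 10 + L ^ 10"
      unfolding M_eq using Lpos by (intro add_mono power_mono power_increasing) auto
    also have "\<dots> = 11 * L ^ 10" by algebra
    also have "\<dots> \<le> 16 * L ^ 10" by simp
    finally have "real (sum_sq_flow (I R) (OPT (I R))) \<le> real (16 * L ^ 10)"
      by (simp only: of_nat_le_iff)
    then have "real (sum_sq_flow (I R) (OPT (I R))) \<le> 16 * real L ^ 10" by simp
    moreover have "real L * real L ^ 10 / 16 \<le> real (sum_sq_flow (I R) (run A (I R)))"
      if feas: "feasible (I R) (run A (I R))" and A: "A \<in> space \<A> - E" for A
    proof -
      \<comment> \<open>Half of \<open>M = (4 * m) ^ 5 = 1024 * m ^ 5\<close>. The two alternatives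
        of \<open>stream_cost\<close> amount to \<open>L ^ 11 / 8\<close> and
        \<open>L ^ 11 / 16\<close>; the latter explains the \<open>16\<close> in the cost bound of
        \<open>ratio\<close>.\<close>
      define H where "H = 512 * m ^ 5"
      have H: "M = 2 * H" by (simp add: M_eq L_def H_def power_mult_distrib)
      have "card {t. t < T * k \<and> run A (I R) t = Some 0} \<ge> 4 * m * k"
        using A by (auto simp: run_busy[OF R] E_def L_def)
      then have "2 * m * H\<^sup>2 \<le> sum_sq_flow (I R) (run A (I R))
          \<or> M * (m * k)\<^sup>2 \<le> sum_sq_flow (I R) (run A (I R))"
        using stream_cost[OF H mpos pos(2)] feas by (simp only: I_def L_def R_def)
      moreover have "real L * real L ^ 10 / 16 \<le> real (2 * m * H\<^sup>2)"
        by (simp add: L_def H_def power_mult_distrib flip: power_mult power_Suc power_add)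
      moreover have "real L * real L ^ 10 / 16 = real (M * (m * k)\<^sup>2)"
        by (simp add: M_eq k_def L_def power_mult_distrib flip: power_mult power_Suc power_add)
      ultimately show ?thesis by (metis of_nat_le_iff order_trans)
    qed
    ultimately show ?thesis using R ratio[OF R _ 2] E by auto
  qed
  then show "\<exists>I. valid_instance I \<and> length I = n \<and> expected_l2_flow \<A> I
      \<ge> ennreal (1 / 64 * real n powr (1 / 10) * sqrt (real (sum_sq_flow I (OPT I))))"
    using valid len by blast
qed

end
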